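(* The algorithm $\textsc{MMS}$ is a $2$-approximation for the maximin support problem: for every election instance, its output $(A,w)$ is a full solution with $\mathrm{supp}_w(A)\ge\mathrm{OPT}/2$. Here $\textsc{MMS}$ is: initialize $A=\emptyset$, $w=0\in\mathbb{R}^E$; for $i=1,\dots,k$: for each $c\in C\setminus A$ compute a weight vector $w_c$ that is balanced for $A\cup\{c\}$; choose $c_i\in\arg\max_{c\in C\setminus A}\mathrm{supp}_{w_c}(A\cup\{c\})$; update $A\leftarrow A\cup\{c_i\}$ and $w\leftarrow w_{c_i}$; return $(A,w)$.
   Context: An election instance consists of a finite bipartite graph $G=(N\cup C,E)$ with no isolated vertices ($N$ = voters, $C$ = candidates), a vector $s\in\mathbb{R}^N$ of non-negative vote strengths, and an integer $k$ with $0<k<|C|$. Write $nc$ for $\{n,c\}$, $C_n=\{c: nc\in E\}$, $N_c=\{n: nc\in E\}$. A weight vector $w\in\mathbb{R}^E$ is feasible if $w\ge0$ and $\sum_{c\in C_n}w_{nc}\le s_n$ for all $n$. $\mathrm{supp}_w(c)=\sum_{n\in N_c}w_{nc}$, $\mathrm{supp}_w(A)=\min_{c\in A}\mathrm{supp}_w(c)$, $\mathrm{supp}_w(\emptyset)=\infty$. A solution is $(A,w)$ with $A\subseteq C$, $|A|\le k$, $w$ feasible; full if $|A|=k$. The maximin support problem maximizes $\mathrm{supp}_w(A)$ over full solutions; OPT denotes the optimal value. A feasible $w$ is balanced for $A$ if it maximizes $\sum_{c\in A}\mathrm{supp}_w(c)$ over all feasible vectors and, among those, minimizes $\sum_{c\in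 A}\mathrm{supp}_w(c)^2$. *)

theory Defs
  imports "HOL-Analysis.Analysis"
begin

(* Voters and candidates live in separate types, so the two sides of the bipartite graph
   are disjoint; the edge nc is the pair (n, c). *)
record ('n, 'c) election =
  voters :: "'n set"
  candidates :: "'c set"
  edges :: "('n \<times> 'c) set"
  strength :: "'n \<Rightarrow> real"
  seats :: nat

definition cands_of :: "('n, 'c) election \<Rightarrow> 'n \<Rightarrow> 'c set" where
  "cands_of I n = {c. (n, c) \<in> edges I}"

definition voters_of :: "('n, 'c) election \<Rightarrow> 'c \<Rightarrow> 'n set" where
  "voters_of I c = {n. (n, c) \<in> edges I}"

definition election_instance :: "('n, 'c) election \<Rightarrow> bool" where
  "election_instance I \<longleftrightarrow>
     finite (voters I) \<and> finite (candidates I) \<and>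
     edges I \<subseteq> voters I \<times> candidates I \<and>
     (\<forall>n\<in>voters I. cands_of I n \<noteq> {}) \<and>
     (\<forall>c\<in>candidates I. voters_of I c \<noteq> {}) \<and>
     (\<forall>n\<in>voters I. strength I n \<ge> 0) \<and>
     0 < seats I \<and> seats I < card (candidates I)"

(* A vector in R^E is a function on all pairs of which only the values on E are ever used. *)
type_synonym ('n, 'c) weights = "'n \<times> 'c \<Rightarrow> real"

definition feasible :: "('n, 'c) election \<Rightarrow> ('n, 'c) weights \<Rightarrow> bool" where
  "feasible I w \<longleftrightarrow>
     (\<forall>e\<in>edges I. w e \<ge> 0) \<and>
     (\<forall>n\<in>voters I. (\<Sum>c\<in>cands_of I n. w (n, c)) \<le> strength I n)"

definition cand_supp :: "('n, 'c) election \<Rightarrow> ('n, 'c) weights \<Rightarrow> 'c \<Rightarrow> real" where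
  "cand_supp I w c = (\<Sum>n\<in>voters_of I c. w (n, c))"

definition set_supp :: "('n, 'c) election \<Rightarrow> ('n, 'c) weights \<Rightarrow> 'c set \<Rightarrow> ereal" where
  "set_supp I w A = (if A = {} then \<infinity> else ereal (Min (cand_supp I w ` A)))"

definition solution :: "('n, 'c) election \<Rightarrow> 'c set \<Rightarrow> ('n, 'c) weights \<Rightarrow> bool" where
  "solution I A w \<longleftrightarrow> A \<subseteq> candidates I \<and> card A \<le> seats I \<and> feasible I w"

definition full_solution :: "('n, 'c) election \<Rightarrow> 'c set \<Rightarrow> ('n, 'c) weights \<Rightarrow> bool" where
  "full_solution I A w \<longleftrightarrow> solution I A w \<and> card A = seats I"

definition OPT :: "('n, 'c) election \<Rightarrow> ereal" where
  "OPT I = Sup {set_supp I w A | A w. full_solution I A w}"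

definition balanced :: "('n, 'c) election \<Rightarrow> 'c set \<Rightarrow> ('n, 'c) weights \<Rightarrow> bool" where
  "balanced I A w \<longleftrightarrow>
     is_arg_min (\<lambda>v. \<Sum>c\<in>A. (cand_supp I v c)\<^sup>2)
       (is_arg_max (\<lambda>v. \<Sum>c\<in>A. cand_supp I v c) (feasible I)) w"

(* mms_state I i A w: some run of the algorithm holds (A, w) after i iterations.  Both the
   balanced vectors wc and the tie-breaking in the arg max are arbitrary choices of the run. *)
inductive mms_state ::
  "('n, 'c) election \<Rightarrow> nat \<Rightarrow> 'c set \<Rightarrow> ('n, 'c) weights \<Rightarrow> bool" for I where
  init: "mms_state I 0 {} (\<lambda>_. 0)"
| step: "mms_state I i A w \<Longrightarrow>
    (\<forall>c \<in> candidates I - A. balanced I (insert c A) (wc c)) \<Longrightarrow>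
    is_arg_max (\<lambda>c. set_supp I (wc c) (insert c A)) (\<lambda>c. c \<in> candidates I - A) d \<Longrightarrow>
    mms_state I (Suc i) (insert d A) (wc d)"

definition mms_output :: "('n, 'c) election \<Rightarrow> 'c set \<Rightarrow> ('n, 'c) weights \<Rightarrow> bool" where
  "mms_output I A w \<longleftrightarrow> mms_state I (seats I) A w"

end

theory Submission
  imports Defs
begin

text \<open>
  Write \<open>g S\<close> for the total strength of the voters adjacent to a candidate of \<open>S\<close>; it is submodular
  and bounds the total support of \<open>S\<close> under any feasible vector. If \<open>w\<close> is balanced for \<open>B\<close>, with
  minimum support \<open>m\<close> attained exactly on \<open>S \<subseteq> B\<close>, then an exchange argument shows that the
  voters adjacent to \<open>S\<close> spend everything on \<open>S\<close>, so \<open>g S = m * card S\<close>.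

  Let \<open>A'\<close> be a full set with all supports at least \<open>2 * r\<close>, and let \<open>A\<close>, with \<open>card A < card A'\<close>,
  have supports at least \<open>r\<close>. If no \<open>c \<in> A' - A\<close> could be added at level \<open>r\<close>, each would give
  a set \<open>S\<^sub>c \<subseteq> A\<close> with \<open>g (insert c S\<^sub>c) < r * card (insert c S\<^sub>c)\<close>, while \<open>g T \<ge> r * card T\<close> for all
  \<open>T \<subseteq> A\<close>. Uncrossing these sets yields \<open>S \<subseteq> A\<close> with \<open>g (S \<union> (A' - A)) < r * card (S \<union> (A' - A))\<close>,
  contradicting \<open>g (S \<union> (A' - A)) \<ge> 2 * r * card ((S \<inter> A') \<union> (A' - A))\<close> and \<open>card A < card A'\<close>.
\<close>

section \<open>Neighbourhood strength: submodularity and bounds on total support\<close>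

definition nbr_strength :: "('n, 'c) election \<Rightarrow> 'c set \<Rightarrow> real" where
  "nbr_strength I S = (\<Sum>n\<in>(\<Union>c\<in>S. voters_of I c). strength I n)"

lemma election_instanceD:
  assumes "election_instance I"
  shows "finite (voters I)" "finite (candidates I)" "edges I \<subseteq> voters I \<times> candidates I"
    "\<And>n. n \<in> voters I \<Longrightarrow> strength I n \<ge> 0"
    "0 < seats I" "seats I < card (candidates I)"
    "finite (edges I)" "\<And>n. finite (cands_of I n)" "\<And>c. finite (voters_of I c)"
    "\<And>c. voters_of I c \<subseteq> voters I"
proof -
  show "finite (voters I)" "finite (candidates I)" and E: "edges I \<subseteq> voters I \<times> candidates I"
    and "\<And>n. n \<in> voters I \<Longrightarrow> strength I n \<ge> 0"
    and "0 < seats I" "seats I < card (candidates I)"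
    using assms unfolding election_instance_def by auto
  then show "finite (edges I)" by (meson finite_SigmaI finite_subset)
  show "finite (cands_of I n)" for n
    by (rule finite_subset[OF _ \<open>finite (candidates I)\<close>]) (use E in \<open>auto simp: cands_of_def\<close>)
  show V: "voters_of I c \<subseteq> voters I" for c
    using E by (auto simp: voters_of_def)
  show "finite (voters_of I c)" for c
    by (rule finite_subset[OF V \<open>finite (voters I)\<close>])
qed

lemma nbr_strength_mono:
  assumes "election_instance I" "S \<subseteq> T"
  shows "nbr_strength I S \<le> nbr_strength I T"
proof -
  note D = election_instanceD[OF assms(1)]
  have V: "(\<Union>c\<in>T. voters_of I c) \<subseteq> voters I" using D(10) by auto
  show ?thesis unfolding nbr_strength_def
    by (rule sum_mono2) (use V assms(2) D(4) finite_subset[OF V D(1)] in \<open>auto\<close>)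
qed

text \<open>The neighbourhood of a union is the union of the neighbourhoods, whereas that of an
  intersection is only contained in their intersection; non-negative strengths turn this inclusion
  into the inequality.\<close>

lemma nbr_strength_submodular:
  assumes "election_instance I"
  shows "nbr_strength I (S \<union> T) + nbr_strength I (S \<inter> T) \<le> nbr_strength I S + nbr_strength I T"
proof -
  note D = election_instanceD[OF assms]
  let ?N = "\<lambda>S. \<Union>c\<in>S. voters_of I c"
  have V: "?N S \<subseteq> voters I" for S using D(10) by auto
  have fin: "finite (?N S)" for S by (rule finite_subset[OF V D(1)])
  have "nbr_strength I (S \<inter> T) \<le> (\<Sum>n\<in>?N S \<inter> ?N T. strength I n)"
    unfolding nbr_strength_def
    by (rule sum_mono2) (use V fin D(4) in auto)
  moreover have "nbr_strength I (S \<union> T) + (\<Sum>n\<in>?N S \<inter> ?N T. strength I n)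
      = nbr_strength I S + nbr_strength I T"
    unfolding nbr_strength_def UN_Un by (rule sum.union_inter[OF fin fin])
  ultimately show ?thesis by linarith
qed

lemma sum_cand_supp_by_voter:
  assumes "election_instance I" "S \<subseteq> candidates I"
  shows "(\<Sum>c\<in>S. cand_supp I w c)
    = (\<Sum>n\<in>(\<Union>c\<in>S. voters_of I c). \<Sum>c\<in>cands_of I n \<inter> S. w (n, c))"
proof -
  note D = election_instanceD[OF assms(1)]
  let ?N = "\<Union>c\<in>S. voters_of I c"
  have fin: "finite S" "finite ?N"
    using assms(2) D(2,9) finite_subset by (blast, meson finite_UN finite_subset)
  have "(\<Sum>c\<in>S. cand_supp I w c) = (\<Sum>c\<in>S. \<Sum>n\<in>{n\<in>?N. (n, c) \<in> edges I}. w (n, c))"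
    unfolding cand_supp_def by (intro sum.cong refl) (auto simp: voters_of_def)
  also have "\<dots> = (\<Sum>n\<in>?N. \<Sum>c\<in>{c\<in>S. (n, c) \<in> edges I}. w (n, c))"
    by (rule sum.swap_restrict[OF fin])
  also have "\<dots> = (\<Sum>n\<in>?N. \<Sum>c\<in>cands_of I n \<inter> S. w (n, c))"
    by (intro sum.cong refl) (auto simp: cands_of_def)
  finally show ?thesis .
qed

lemma sum_cand_supp_le_nbr_strength:
  assumes "election_instance I" "S \<subseteq> candidates I" "feasible I w"
  shows "(\<Sum>c\<in>S. cand_supp I w c) \<le> nbr_strength I S"
  unfolding sum_cand_supp_by_voter[OF assms(1,2)] nbr_strength_def
proof (rule sum_mono)
  note D = election_instanceD[OF assms(1)]
  fix n assume "n \<in> (\<Union>c\<in>S. voters_of I c)"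
  then have n: "n \<in> voters I" using D(10) by auto
  have "(\<Sum>c\<in>cands_of I n \<inter> S. w (n, c)) \<le> (\<Sum>c\<in>cands_of I n. w (n, c))"
    by (rule sum_mono2) (use D(8) assms(3) in \<open>auto simp: feasible_def cands_of_def\<close>)
  also have "\<dots> \<le> strength I n" using assms(3) n by (auto simp: feasible_def)
  finally show "(\<Sum>c\<in>cands_of I n \<inter> S. w (n, c)) \<le> strength I n" .
qed

text \<open>Used at level \<open>r\<close> for subsets of the current set \<open>A\<close>, and at
  level \<open>2 * r\<close> for subsets of the competing set \<open>A'\<close>.\<close>

lemma card_le_nbr_strength:
  assumes "election_instance I" "S \<subseteq> candidates I" "feasible I w"
    and "\<And>c. c \<in> S \<Longrightarrow> r \<le> cand_supp I w c"
  shows "r * card S \<le> nbr_strength I S"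
  using sum_bounded_below[of S r "cand_supp I w"] assms(4)
    sum_cand_supp_le_nbr_strength[OF assms(1-3)]
  by (simp add: mult.commute)

section \<open>Changing the weight of a single edge\<close>

text \<open>The injection \<open>f\<close> is \<open>\<lambda>n. (n, c)\<close> for the support of a
  candidate and \<open>\<lambda>c. (n, c)\<close> for the load of a voter.\<close>

lemma sum_fun_upd:
  fixes w :: "'a \<Rightarrow> real"
  assumes "finite A" "inj_on f A" "a \<in> A"
  shows "(\<Sum>x\<in>A. (w(f a := y)) (f x)) = (\<Sum>x\<in>A. w (f x)) + (y - w (f a))"
proof -
  have "(\<Sum>x\<in>A. (w(f a := y)) (f x)) = (\<Sum>x\<in>A. w (f x) + (if x = a then y - w (f a) else 0))"
    by (intro sum.cong refl) (use assms(2,3) in \<open>auto dest: inj_onD\<close>)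
  then show ?thesis using assms(1,3) by (simp add: sum.distrib)
qed

lemma cand_supp_upd:
  assumes "election_instance I" "(n, c) \<in> edges I"
  shows "cand_supp I (w((n, c) := y)) c' = cand_supp I w c' + (if c' = c then y - w (n, c) else 0)"
proof (cases "c' = c")
  case True
  have "n \<in> voters_of I c" using assms(2) by (simp add: voters_of_def)
  from sum_fun_upd[OF election_instanceD(9)[OF assms(1)] _ this, of "\<lambda>n. (n, c)" w y]
  show ?thesis by (simp add: cand_supp_def True inj_on_def)
qed (auto simp: cand_supp_def)

lemma voter_load_upd:
  fixes w :: "('n, 'c) weights"
  assumes "election_instance I" "(n, c) \<in> edges I"
  shows "(\<Sum>c'\<in>cands_of I n'. (w((n, c) := y)) (n', c'))
    = (\<Sum>c'\<in>cands_of I n'. w (n', c')) + (if n' = n then y - w (n, c) else 0)"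
proof (cases "n' = n")
  case True
  have "c \<in> cands_of I n" using assms(2) by (simp add: cands_of_def)
  from sum_fun_upd[OF election_instanceD(8)[OF assms(1)] _ this, of "\<lambda>c. (n, c)" w y]
  show ?thesis by (simp add: True inj_on_def)
qed auto

section \<open>Exchange arguments for balanced vectors\<close>

lemma balanced_feasible: "balanced I B w \<Longrightarrow> feasible I w"
  by (auto simp: balanced_def is_arg_min_def is_arg_max_def)

lemma balanced_total_max:
  assumes "balanced I B w" "feasible I v"
  shows "(\<Sum>c\<in>B. cand_supp I v c) \<le> (\<Sum>c\<in>B. cand_supp I w c)"
  using assms by (force simp: balanced_def is_arg_min_def is_arg_max_def)

lemma balanced_squares_min:
  assumes "balanced I B w" "feasible I v"
    and "(\<Sum>c\<in>B. cand_supp I v c) = (\<Sum>c\<in>B. cand_supp I w c)"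
  shows "(\<Sum>c\<in>B. (cand_supp I w c)\<^sup>2) \<le> (\<Sum>c\<in>B. (cand_supp I v c)\<^sup>2)"
  using assms by (force simp: balanced_def is_arg_min_def is_arg_max_def)

text \<open>Unspent strength of \<open>n\<close> could be placed on the edge to \<open>c\<close>,
  which would raise the total support of \<open>B\<close>.\<close>

lemma balanced_voter_exhausted:
  assumes "election_instance I" "B \<subseteq> candidates I" "balanced I B w"
    and "c \<in> B" "(n, c) \<in> edges I"
  shows "(\<Sum>c'\<in>cands_of I n. w (n, c')) = strength I n"
proof (rule ccontr)
  note D = election_instanceD[OF assms(1)]
  have F: "feasible I w" by (rule balanced_feasible[OF assms(3)])
  have finB: "finite B" using assms(2) D(2) finite_subset by blast
  have n: "n \<in> voters I" using D(3) assms(5) by auto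
  define d where "d = strength I n - (\<Sum>c'\<in>cands_of I n. w (n, c'))"
  assume "\<not> ?thesis"
  then have d: "d > 0" using F n by (force simp: feasible_def d_def)
  let ?v = "w((n, c) := w (n, c) + d)"
  have "feasible I ?v"
    unfolding feasible_def voter_load_upd[OF assms(1,5)]
    using F d by (auto simp: feasible_def d_def)
  then have "(\<Sum>c\<in>B. cand_supp I ?v c) \<le> (\<Sum>c\<in>B. cand_supp I w c)"
    by (rule balanced_total_max[OF assms(3)])
  then show False
    using d finB assms(4) by (simp add: cand_supp_upd[OF assms(1,5)] sum.distrib)
qed

text \<open>Otherwise \<open>n\<close> could shift weight from \<open>c'\<close> to
  \<open>c\<close>. If \<open>c'\<close> lies outside \<open>B\<close>, the total support of
  \<open>B\<close> grows; if it lies in \<open>B\<close> with larger support, the total stays fixed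
  and the sum of squares drops.\<close>

lemma balanced_no_weight_above:
  assumes "election_instance I" "B \<subseteq> candidates I" "balanced I B w"
    and "c \<in> B" "(n, c) \<in> edges I" "(n, c') \<in> edges I"
    and "c' \<in> B \<Longrightarrow> cand_supp I w c < cand_supp I w c'" "c' \<noteq> c"
  shows "w (n, c') = 0"
proof (rule ccontr)
  note D = election_instanceD[OF assms(1)]
  have F: "feasible I w" by (rule balanced_feasible[OF assms(3)])
  have finB: "finite B" using assms(2) D(2) finite_subset by blast
  let ?m = "cand_supp I w c" and ?M = "cand_supp I w c'"
  assume "w (n, c') \<noteq> 0"
  then have pos: "w (n, c') > 0" using F assms(6) by (force simp: feasible_def)
  \<comment> \<open>The bound \<open>w (n, c')\<close> keeps the new weight non-negative; half of
    the gap keeps \<open>d\<close> strictly below the gap.\<close>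
  define d where "d = (if c' \<in> B then min (w (n, c')) ((?M - ?m) / 2) else w (n, c'))"
  have d: "d > 0" "d \<le> w (n, c')" and dM: "c' \<in> B \<Longrightarrow> d < ?M - ?m"
    using pos assms(7) by (auto simp: d_def min_def field_simps)
  let ?v = "w((n, c) := w (n, c) + d, (n, c') := w (n, c') - d)"
  have supp: "cand_supp I ?v x
      = cand_supp I w x + (if x = c then d else 0) - (if x = c' then d else 0)" for x
    using assms(8) by (simp add: cand_supp_upd[OF assms(1,5)] cand_supp_upd[OF assms(1,6)])
  have Fv: "feasible I ?v"
    unfolding feasible_def voter_load_upd[OF assms(1,5)] voter_load_upd[OF assms(1,6)]
    using F d assms(8) by (auto simp: feasible_def)
  have total: "(\<Sum>x\<in>B. cand_supp I ?v x)
      = (\<Sum>x\<in>B. cand_supp I w x) + d - (if c' \<in> B then d else 0)"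
    unfolding supp using finB assms(4) by (simp add: sum.distrib sum_subtractf)
  show False
  proof (cases "c' \<in> B")
    case False
    then show False using total balanced_total_max[OF assms(3) Fv] d by simp
  next
    case True
    have "(\<Sum>x\<in>B. (cand_supp I ?v x)\<^sup>2)
      = (\<Sum>x\<in>B. (cand_supp I w x)\<^sup>2 + (if x = c then 2 * d * ?m + d\<^sup>2 else 0)
            + (if x = c' then d\<^sup>2 - 2 * d * ?M else 0))"
      unfolding supp using assms(8)
      by (intro sum.cong refl) (auto simp: power2_eq_square algebra_simps)
    \<comment> \<open>The change \<open>2 * d * (?m + d - ?M)\<close> is negative exactly because
      \<open>0 < d < ?M - ?m\<close>.\<close>
    also have "\<dots> = (\<Sum>x\<in>B. (cand_supp I w x)\<^sup>2) + 2 * d * (?m + d - ?M)"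
      using finB assms(4) True by (simp add: sum.distrib power2_eq_square algebra_simps)
    also have "\<dots> < (\<Sum>x\<in>B. (cand_supp I w x)\<^sup>2)"
      using d(1) dM[OF True] by (simp add: mult_pos_neg)
    finally show False using balanced_squares_min[OF assms(3) Fv] total True by simp
  qed
qed

text \<open>A voter adjacent to \<open>S\<close> spends its whole strength, and by the exchange
  lemma none of it on candidates outside \<open>S\<close>: these are outside \<open>B\<close> or
  have support above \<open>m\<close>.\<close>

lemma balanced_min_level_tight:
  assumes "election_instance I" "B \<subseteq> candidates I" "balanced I B w"
    and m: "\<And>c. c \<in> B \<Longrightarrow> m \<le> cand_supp I w c"
    and S: "S = {c\<in>B. cand_supp I w c = m}"
  shows "nbr_strength I S = m * card S"
proof -
  note D = election_instanceD[OF assms(1)]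
  have SC: "S \<subseteq> candidates I" using S assms(2) by auto
  have "(\<Sum>c\<in>cands_of I n \<inter> S. w (n, c)) = strength I n" if n: "n \<in> (\<Union>c\<in>S. voters_of I c)" for n
  proof -
    obtain c where c: "c \<in> S" "(n, c) \<in> edges I" using n by (auto simp: voters_of_def)
    have cB: "c \<in> B" and cm: "cand_supp I w c = m" using c S by auto
    have "(\<Sum>c\<in>cands_of I n \<inter> S. w (n, c)) = (\<Sum>c\<in>cands_of I n. w (n, c))"
    proof (rule sum.mono_neutral_left)
      show "\<forall>c'\<in>cands_of I n - cands_of I n \<inter> S. w (n, c') = 0"
      proof
        fix c' assume c': "c' \<in> cands_of I n - cands_of I n \<inter> S"
        show "w (n, c') = 0"
        proof (rule balanced_no_weight_above[OF assms(1-3) cB c(2)])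
          show "(n, c') \<in> edges I" using c' by (auto simp: cands_of_def)
          show "c' \<noteq> c" using c c' by auto
          show "cand_supp I w c < cand_supp I w c'" if "c' \<in> B"
            using m[OF that] cm c' S that by force
        qed
      qed
    qed (use D(8) in auto)
    then show ?thesis
      using balanced_voter_exhausted[OF assms(1-3) cB c(2)] by simp
  qed
  then have "nbr_strength I S = (\<Sum>c\<in>S. cand_supp I w c)"
    unfolding sum_cand_supp_by_voter[OF assms(1) SC] nbr_strength_def by simp
  also have "\<dots> = m * card S" using S by simp
  finally show ?thesis .
qed

lemma balanced_violating_set:
  assumes "election_instance I" "B \<subseteq> candidates I" "balanced I B w"
    and "b \<in> B" "cand_supp I w b < r"
  obtains S where "S \<subseteq> B" "nbr_strength I S < r * card S"
proof -
  have finB: "finite B" using assms(2) election_instanceD(2)[OF assms(1)] finite_subset by blast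
  define m where "m = Min (cand_supp I w ` B)"
  define S where "S = {c\<in>B. cand_supp I w c = m}"
  have m: "m \<le> cand_supp I w c" if "c \<in> B" for c
    using finB that by (auto simp: m_def)
  have "m \<in> cand_supp I w ` B" unfolding m_def by (rule Min_in) (use finB assms(4) in auto)
  then have "card S > 0" using finB by (auto simp: S_def card_gt_0_iff)
  moreover have "m < r" using m[OF assms(4)] assms(5) by simp
  ultimately have "nbr_strength I S < r * card S"
    using balanced_min_level_tight[OF assms(1-3) m S_def] by simp
  then show thesis by (intro that[of S]) (auto simp: S_def)
qed

section \<open>Existence of balanced vectors by compactness\<close>

lemma compact_box_fun:
  fixes K :: "'a \<Rightarrow> 'b::topological_space set"
  assumes "\<And>e. compact (K e)"
  shows "compact {w. \<forall>e. w e \<in> K e}"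
proof -
  have "compactin (product_topology (\<lambda>_. euclidean) UNIV) (PiE UNIV K)"
    using assms by (subst compactin_PiE) auto
  moreover have "PiE UNIV K = {w. \<forall>e. w e \<in> K e}" by auto
  ultimately show ?thesis by (simp add: euclidean_product_topology)
qed

lemma continuous_on_cand_supp [continuous_intros]:
  "continuous_on X (\<lambda>w. cand_supp I w c)"
  unfolding cand_supp_def
  by (intro continuous_on_sum continuous_on_subset[OF continuous_on_product_coordinates]) auto

text \<open>Ensures that the algorithm never gets stuck. Continuous functions attain the two optima
  in turn, first on a compact set of feasible vectors and then on its closed subset of
  maximizers.\<close>

lemma balanced_exists:
  assumes "election_instance I"
  shows "\<exists>w. balanced I B w"
proof -
  note D = election_instanceD[OF assms]
  \<comment> \<open>Feasibility leaves values off the edges free, so they are pinned to 0 to obtain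
    a compact set.\<close>
  define K where "K = (\<lambda>e. if e \<in> edges I then {0..strength I (fst e)} else {0})"
  define F where "F = {w. \<forall>e. w e \<in> K e} \<inter>
    (\<Inter>n\<in>voters I. {w. (\<Sum>c\<in>cands_of I n. w (n, c)) \<le> strength I n})"
  have "compact {w. \<forall>e. w e \<in> K e}" by (rule compact_box_fun) (auto simp: K_def)
  moreover have "closed {w. (\<Sum>c\<in>cands_of I n. w (n, c)) \<le> strength I n}" for n
    by (intro closed_Collect_le continuous_on_sum continuous_on_product_coordinates
        continuous_on_const)
  ultimately have compF: "compact F" unfolding F_def by (intro compact_Int_closed closed_INT) auto
  have "(\<lambda>_. 0) \<in> F" using D(3,4) by (auto simp: F_def K_def)
  then have neF: "F \<noteq> {}" by auto
  have feasF: "feasible I w" if "w \<in> F" for w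
    using that by (force simp: F_def K_def feasible_def split: if_splits)
  \<comment> \<open>Zeroing a feasible vector off the edges keeps all supports, so optimality over
    \<open>F\<close> carries over to all feasible vectors.\<close>
  have restr: "\<exists>u\<in>F. cand_supp I u = cand_supp I v" if v: "feasible I v" for v
  proof
    let ?u = "\<lambda>e. if e \<in> edges I then v e else 0"
    have load: "(\<Sum>c\<in>cands_of I n. ?u (n, c)) = (\<Sum>c\<in>cands_of I n. v (n, c))" for n
      by (intro sum.cong refl) (auto simp: cands_of_def)
    have "v (n, c) \<le> strength I n" if "(n, c) \<in> edges I" for n c
    proof -
      have "v (n, c) \<le> (\<Sum>c\<in>cands_of I n. v (n, c))"
        by (rule member_le_sum) (use that v D(8) in \<open>auto simp: cands_of_def feasible_def\<close>)
      also have "\<dots> \<le> strength I n" using v that D(3) by (auto simp: feasible_def)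
      finally show ?thesis .
    qed
    then have "?u \<in> {w. \<forall>e. w e \<in> K e}" using v by (auto simp: K_def feasible_def)
    then show "?u \<in> F" using v unfolding F_def by (simp add: load feasible_def)
    show "cand_supp I ?u = cand_supp I v"
      by (rule ext, unfold cand_supp_def, intro sum.cong refl) (auto simp: voters_of_def)
  qed
  have cont: "continuous_on X (\<lambda>w. \<Sum>c\<in>B. cand_supp I w c)" for X
    by (intro continuous_intros)
  obtain u where u: "u \<in> F" "\<And>v. v \<in> F \<Longrightarrow> (\<Sum>c\<in>B. cand_supp I v c) \<le> (\<Sum>c\<in>B. cand_supp I u c)"
    using continuous_attains_sup[OF compF neF cont] by blast
  define G where "G = F \<inter> {w. (\<Sum>c\<in>B. cand_supp I w c) = (\<Sum>c\<in>B. cand_supp I u c)}"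
  have "compact G" unfolding G_def
    by (intro compact_Int_closed compF closed_Collect_eq continuous_intros)
  moreover have "G \<noteq> {}" using u by (auto simp: G_def)
  moreover have "continuous_on G (\<lambda>w. \<Sum>c\<in>B. (cand_supp I w c)\<^sup>2)"
    by (intro continuous_intros)
  ultimately have "\<exists>w\<in>G. \<forall>v\<in>G. (\<Sum>c\<in>B. (cand_supp I w c)\<^sup>2) \<le> (\<Sum>c\<in>B. (cand_supp I v c)\<^sup>2)"
    by (rule continuous_attains_inf)
  then obtain w where w: "w \<in> G"
    "\<And>v. v \<in> G \<Longrightarrow> (\<Sum>c\<in>B. (cand_supp I w c)\<^sup>2) \<le> (\<Sum>c\<in>B. (cand_supp I v c)\<^sup>2)"
    by blast
  have total: "(\<Sum>c\<in>B. cand_supp I v c) \<le> (\<Sum>c\<in>B. cand_supp I w c)" if "feasible I v" for v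
    using restr[OF that] u(2) w(1) by (force simp: G_def)
  have "(\<Sum>c\<in>B. (cand_supp I w c)\<^sup>2) \<le> (\<Sum>c\<in>B. (cand_supp I v c)\<^sup>2)"
    if v: "feasible I v" "(\<Sum>c\<in>B. cand_supp I w c) \<le> (\<Sum>c\<in>B. cand_supp I v c)" for v
  proof -
    obtain v' where v': "v' \<in> F" "cand_supp I v' = cand_supp I v" using restr[OF v(1)] by blast
    have "v' \<in> G" using v' v(2) total[OF v(1)] w(1) by (simp add: G_def)
    then show ?thesis using w(2) v'(2) by metis
  qed
  then have "balanced I B w"
    unfolding balanced_def is_arg_min_def is_arg_max_def not_less not_ex de_Morgan_conj
    using w(1) feasF total by (force simp: G_def not_less)
  then show ?thesis by blast
qed

section \<open>Extending a set while keeping half of the competing level\<close>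

lemma extension_at_half_level:
  assumes I: "election_instance I"
    and A: "A \<subseteq> candidates I" "feasible I w" "\<And>c. c \<in> A \<Longrightarrow> r \<le> cand_supp I w c"
    and A': "A' \<subseteq> candidates I" "feasible I w'" "\<And>c. c \<in> A' \<Longrightarrow> 2 * r \<le> cand_supp I w' c"
    and r: "0 \<le> r" and card: "card A < card A'"
    and bal: "\<And>c. c \<in> A' - A \<Longrightarrow> balanced I (insert c A) (wc c)"
  shows "\<exists>c\<in>A' - A. \<forall>b\<in>insert c A. r \<le> cand_supp I (wc c) b"
proof (rule ccontr)
  assume neg: "\<not> ?thesis"
  note D = election_instanceD[OF I]
  have fin: "finite A" "finite A'" using A(1) A'(1) D(2) finite_subset by blast+
  \<comment> \<open>The slack of a set at level \<open>r\<close>; it inherits submodularity, since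
    the subtracted term is modular.\<close>
  define h where "h = (\<lambda>S. nbr_strength I S - r * card S)"
  have h_nonneg: "0 \<le> h T" if "T \<subseteq> A" for T
    using card_le_nbr_strength[OF I _ A(2), of T r] that A by (auto simp: h_def)
  have h_submod: "h (S \<union> T) + h (S \<inter> T) \<le> h S + h T" if "finite S" "finite T" for S T
    using nbr_strength_submodular[OF I, of S T] card_Un_Int[OF that]
    by (simp add: h_def algebra_simps flip: of_nat_add distrib_left)
  have viol: "\<exists>S\<subseteq>A. h (insert c S) < 0" if c: "c \<in> A' - A" for c
  proof -
    obtain b where b: "b \<in> insert c A" "cand_supp I (wc c) b < r" using neg c by force
    have "insert c A \<subseteq> candidates I" using c A(1) A'(1) by auto
    then obtain S where S: "S \<subseteq> insert c A" "nbr_strength I S < r * card S"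
      using balanced_violating_set[OF I _ bal[OF c] b] by blast
    then have "h S < 0" by (simp add: h_def)
    \<comment> \<open>Subsets of \<open>A\<close> have non-negative slack, so a violating set must
      contain the new candidate.\<close>
    then have "c \<in> S" using h_nonneg[of S] S(1) by force
    then show ?thesis using S(1) \<open>h S < 0\<close> by (intro exI[of _ "S - {c}"]) (auto simp: insert_absorb)
  qed
  have "\<exists>S\<subseteq>A. h (S \<union> X) < 0" if "finite X" "X \<noteq> {}" "X \<subseteq> A' - A" for X
    using that
  proof (induction rule: finite_ne_induct)
    case (singleton c)
    then show ?case using viol[of c] by auto
  next
    case (insert c X)
    obtain S where S: "S \<subseteq> A" "h (S \<union> X) < 0" using insert by auto
    obtain T where T: "T \<subseteq> A" "h (insert c T) < 0" using insert viol[of c] by auto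
    \<comment> \<open>Uncrossing: the intersection has non-negative slack because
      \<open>c \<notin> X\<close>, so submodularity makes the slack of the union negative.\<close>
    have "(S \<union> X) \<inter> insert c T \<subseteq> A" using insert S T by auto
    from h_nonneg[OF this] have "h ((S \<union> X) \<union> insert c T) < 0"
      using h_submod[of "S \<union> X" "insert c T"] S T insert.hyps(1) fin(1) finite_subset[of _ A]
      by fastforce
    moreover have "(S \<union> X) \<union> insert c T = (S \<union> T) \<union> insert c X" by auto
    ultimately show ?case using S T by (intro exI[of _ "S \<union> T"]) auto
  qed
  moreover have "A' - A \<noteq> {}" using card card_mono[OF fin(1), of A'] by auto
  ultimately obtain S where S: "S \<subseteq> A" "h (S \<union> (A' - A)) < 0" using fin by blast
  have finS: "finite S" using S(1) fin(1) finite_subset by blast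
  have "2 * r * card ((S \<inter> A') \<union> (A' - A)) \<le> nbr_strength I ((S \<inter> A') \<union> (A' - A))"
    by (rule card_le_nbr_strength[OF I _ A'(2)]) (use A' in auto)
  also have "\<dots> \<le> nbr_strength I (S \<union> (A' - A))"
    by (rule nbr_strength_mono[OF I]) auto
  also have "\<dots> < r * card (S \<union> (A' - A))" using S(2) by (simp add: h_def)
  finally have lt: "r * (2 * card ((S \<inter> A') \<union> (A' - A))) < r * card (S \<union> (A' - A))"
    by (simp add: mult_ac)
  \<comment> \<open>Strictness of \<open>lt\<close> excludes \<open>r = 0\<close>, so
    \<open>r\<close> cancels. The counts below then give
    \<open>card (A' - A) < card (A - A')\<close>, against \<open>card A < card A'\<close>.\<close>
  have "2 * card ((S \<inter> A') \<union> (A' - A)) < card (S \<union> (A' - A))"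
    using lt r by (metis mult_less_cancel_left_disj not_less of_nat_less_iff)
  moreover have "card ((S \<inter> A') \<union> (A' - A)) = card (S \<inter> A') + card (A' - A)"
    by (rule card_Un_disjoint) (use S fin finS in auto)
  moreover have "card (S \<union> (A' - A)) = card S + card (A' - A)"
    by (rule card_Un_disjoint) (use S fin finS in auto)
  moreover have "card S = card (S \<inter> A') + card (S - A')"
    using finS by (metis card_Int_Diff)
  moreover have "card (S - A') \<le> card (A - A')"
    by (rule card_mono) (use S fin in auto)
  moreover have "card A = card (A \<inter> A') + card (A - A')" "card A' = card (A \<inter> A') + card (A' - A)"
    using fin by (metis card_Int_Diff, metis card_Int_Diff Int_commute)
  ultimately show False using card by linarith
qed

section \<open>Runs of the algorithm and the approximation ratio\<close>

lemma set_supp_ge_iff: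
  assumes "finite A"
  shows "ereal r \<le> set_supp I w A \<longleftrightarrow> (\<forall>c\<in>A. r \<le> cand_supp I w c)"
  using assms by (auto simp: set_supp_def)

lemma mms_state_invariant:
  assumes "election_instance I" "mms_state I i A w" "i \<le> seats I"
  shows "A \<subseteq> candidates I \<and> card A = i \<and> feasible I w"
  using assms(2,3)
proof induction
  case init
  then show ?case using election_instanceD(4)[OF assms(1)] by (auto simp: feasible_def)
next
  case (step i A w wc d)
  then have d: "d \<in> candidates I - A" by (simp add: is_arg_max_def)
  moreover have "finite A"
    using step election_instanceD(2)[OF assms(1)] finite_subset by fastforce
  moreover have "feasible I (wc d)" using step.hyps(2) d balanced_feasible by blast
  ultimately show ?case using step by auto
qed

lemma mms_state_exists:
  assumes "election_instance I" "i \<le> seats I"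
  shows "\<exists>A w. mms_state I i A w"
  using assms(2)
proof (induction i)
  case 0
  show ?case using mms_state.init by blast
next
  case (Suc i)
  note D = election_instanceD[OF assms(1)]
  obtain A w where A: "mms_state I i A w" using Suc by auto
  have "A \<subseteq> candidates I" "card A = i" using mms_state_invariant[OF assms(1) A] Suc by auto
  \<comment> \<open>Here \<open>card A = i < seats I < card (candidates I)\<close>.\<close>
  then have "candidates I - A \<noteq> {}" using Suc.prems D(6) by auto
  have "\<forall>c. \<exists>v. balanced I (insert c A) v" using balanced_exists[OF assms(1)] by blast
  from choice[OF this] obtain wc
    where wc: "\<forall>c\<in>candidates I - A. balanced I (insert c A) (wc c)" by blast
  let ?f = "\<lambda>c. set_supp I (wc c) (insert c A)"
  have fin: "finite (?f ` (candidates I - A))" using D(2) by auto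
  have "Max (?f ` (candidates I - A)) \<in> ?f ` (candidates I - A)"
    by (rule Max_in[OF fin]) (use \<open>candidates I - A \<noteq> {}\<close> in auto)
  then obtain d where d: "d \<in> candidates I - A" "?f d = Max (?f ` (candidates I - A))" by auto
  have "?f c \<le> ?f d" if "c \<in> candidates I - A" for c
    unfolding d(2) by (rule Max_ge[OF fin imageI[OF that]])
  then have "is_arg_max ?f (\<lambda>c. c \<in> candidates I - A) d"
    using d(1) by (auto simp: is_arg_max_def not_less)
  from mms_state.step[OF A wc this] show ?case by blast
qed

text \<open>The same competitor \<open>A'\<close> is used in every iteration: some member of
  \<open>A' - A\<close> keeps level \<open>r\<close>, and the greedy choice does at least as
  well.\<close>

lemma mms_state_half_level:
  assumes "election_instance I" "mms_state I i A w" "i \<le> seats I"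
    and A': "full_solution I A' w'" "\<And>c. c \<in> A' \<Longrightarrow> 2 * r \<le> cand_supp I w' c" and r: "0 \<le> r"
  shows "\<forall>c\<in>A. r \<le> cand_supp I w c"
  using assms(2,3)
proof induction
  case init
  then show ?case by simp
next
  case (step i A w wc d)
  have inv: "A \<subseteq> candidates I" "card A = i" "feasible I w"
    using mms_state_invariant[OF assms(1) step.hyps(1)] step.prems by auto
  have finA: "finite A" using inv(1) election_instanceD(2)[OF assms(1)] finite_subset by blast
  have full: "A' \<subseteq> candidates I" "feasible I w'" "card A' = seats I"
    using A'(1) by (auto simp: full_solution_def solution_def)
  have "\<exists>c\<in>A' - A. \<forall>b\<in>insert c A. r \<le> cand_supp I (wc c) b"
    by (rule extension_at_half_level[OF assms(1) inv(1,3) _ full(1,2) A'(2) r])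
      (use step inv full in auto)
  then obtain c where c: "c \<in> A' - A" "ereal r \<le> set_supp I (wc c) (insert c A)"
    using finA by (auto simp: set_supp_ge_iff)
  have "set_supp I (wc c) (insert c A) \<le> set_supp I (wc d) (insert d A)"
    using step.hyps(3) c(1) full(1) by (auto simp: is_arg_max_def not_less)
  with c(2) have "ereal r \<le> set_supp I (wc d) (insert d A)" by (rule order_trans)
  then show ?case using finA set_supp_ge_iff[of "insert d A"] by blast
qed

theorem theorem4:
  fixes I :: "('n, 'c) election"
  assumes "election_instance I"
  shows "(\<exists>A w. mms_output I A w) \<and>
    (\<forall>A w. mms_output I A w \<longrightarrow> full_solution I A w \<and> set_supp I w A \<ge> OPT I / 2)"
proof (intro conjI allI impI)
  note D = election_instanceD[OF assms]
  show "\<exists>A w. mms_output I A w"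
    unfolding mms_output_def by (rule mms_state_exists[OF assms order_refl])
  fix A w assume "mms_output I A w"
  then have out: "mms_state I (seats I) A w" by (simp add: mms_output_def)
  note inv = mms_state_invariant[OF assms out order_refl]
  then show "full_solution I A w" by (simp add: full_solution_def solution_def)
  have finA: "finite A" and "A \<noteq> {}" using inv D(2,5) finite_subset by (blast, auto)
  then obtain m where m: "set_supp I w A = ereal m" by (simp add: set_supp_def)
  \<comment> \<open>\<open>OPT\<close> is a supremum, so every full solution is bounded separately,
    with \<open>r\<close> equal to half of its own minimum support \<open>t\<close>.\<close>
  have "set_supp I w' A' \<le> ereal (2 * m)" if full: "full_solution I A' w'" for A' w'
  proof -
    have A': "A' \<subseteq> candidates I" "card A' = seats I" "feasible I w'"
      using full by (auto simp: full_solution_def solution_def)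
    then have finA': "finite A'" and ne: "A' \<noteq> {}" using D(2,5) finite_subset by (blast, auto)
    define t where "t = Min (cand_supp I w' ` A')"
    have t: "t \<le> cand_supp I w' c" if "c \<in> A'" for c
      using that finA' by (auto simp: t_def)
    have "0 \<le> cand_supp I w' c" for c
      unfolding cand_supp_def using A'(3)
      by (intro sum_nonneg) (auto simp: feasible_def voters_of_def)
    then have "0 \<le> t" using finA' ne by (simp add: t_def)
    then have "\<forall>c\<in>A. t / 2 \<le> cand_supp I w c"
      by (intro mms_state_half_level[OF assms out order_refl full]) (use t in auto)
    then have "ereal (t / 2) \<le> ereal m" unfolding set_supp_ge_iff[OF finA, symmetric] m .
    then have "t / 2 \<le> m" by simp
    then show ?thesis using ne by (simp add: set_supp_def t_def)
  qed
  then have "OPT I \<le> ereal (2 * m)" unfolding OPT_def by (intro Sup_least) auto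
  then have "OPT I / 2 \<le> ereal (2 * m) / 2" by (intro ereal_divide_right_mono) auto
  then show "OPT I / 2 \<le> set_supp I w A" by (simp add: m)
qed

end
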